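(* For any admissible distribution $P$ on $[0,1]^n$, any horizon length $T\ge1$, and any Hölder-mean welfare $w_q$ with $q\in[-\infty,1]$, $$\mathbb{E}[\mathsf{OPT}]\le\mathsf{FLU}.$$
   Context: There are $n$ agents and $T$ periods. $\Delta_n=\{x\in\mathbb{R}_+^n:\sum_i x^i=1\}$. A distribution $P$ on $[0,1]^n$ is admissible if it has finite support: $P\{b=\beta_\ell\}=p_\ell>0$ for $\ell\in[L]=\{1,\dots,L\}$, with distinct $\beta_\ell\in[0,1]^n$ and $\sum_\ell p_\ell=1$. The marginal utility vectors $b_1,\dots,b_T$ are i.i.d. with law $P$. Hölder means on $\mathbb{R}_+^n$: $w_{-\infty}(B)=\min_i B^i$; for $q\in(-\infty,0)$, $w_q(B)=\left(\frac1n\sum_i (B^i)^q\right)^{1/q}$ if all $B^i>0$ and $w_q(B)=0$ otherwise; $w_0(B)=\left(\prod_i B^i\right)^{1/n}$; for $q\in(0,1]$, $w_q(B)=\left(\frac1n\sum_i (B^i)^q\right)^{1/q}$. Hindsight optimum: $\mathsf{OPT}=\max\left\{w_q\left(\left(\sum_{t=1}^T b_t^i x_t^i\right)_{i}\right): x_1,\dots,x_T\in\Delta_n\right\}$ for the realized sequence. Fluid benchmark: $\mathsf{FLU}=\max\left\{w_q\left(\left(T\sum_{\ell\in[L]}p_\ell\beta_\ell^i\xi_\ell^i\right)_{i}\right):\boldsymbol\xi=(\xi_\ell)_{\ell\in[L]}\in\Delta_n^L\right\}$. *)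

theory Defs
  imports "HOL-Probability.Probability"
begin

definition unit_cube :: "(real ^ 'n) set" where
  "unit_cube = {b. \<forall>i. 0 \<le> b $ i \<and> b $ i \<le> 1}"

definition std_simplex :: "(real ^ 'n) set" where
  "std_simplex = {x. (\<forall>i. 0 \<le> x $ i) \<and> (\<Sum>i\<in>UNIV. x $ i) = 1}"

text \<open>\<open>P\<close> is a probability measure on the Borel sets of the unit cube (so its space is the
  cube), with atoms \<open>\<beta> 1, \<dots>, \<beta> L\<close> of masses \<open>p 1, \<dots>, p L\<close>.
  Values of \<open>\<beta>\<close> and \<open>p\<close> outside \<open>{1..L}\<close> are irrelevant.\<close>
definition admissible ::
  "(real ^ 'n) measure \<Rightarrow> nat \<Rightarrow> (nat \<Rightarrow> real) \<Rightarrow> (nat \<Rightarrow> real ^ 'n) \<Rightarrow> bool" where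
  "admissible P L p \<beta> \<longleftrightarrow>
     prob_space P \<and>
     sets P = sets (restrict_space borel unit_cube) \<and>
     (\<forall>l\<in>{1..L}. \<beta> l \<in> unit_cube) \<and>
     inj_on \<beta> {1..L} \<and>
     (\<forall>l\<in>{1..L}. p l > 0 \<and> measure P {\<beta> l} = p l) \<and>
     (\<Sum>l\<in>{1..L}. p l) = 1"

text \<open>Meant for exponents \<open>q \<le> 1\<close> and vectors with nonnegative entries. For \<open>0 < q\<close> the
  convention \<open>0 powr a = 0\<close> gives the usual value at vectors with vanishing entries.\<close>
definition holder_mean :: "ereal \<Rightarrow> real ^ 'n \<Rightarrow> real" where
  "holder_mean q B =
     (if q = -\<infinity> then Min (range (\<lambda>i. B $ i))
      else if q < 0 \<and> \<not> (\<forall>i. 0 < B $ i) then 0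
      else if q = 0 then root CARD('n) (\<Prod>i\<in>UNIV. B $ i)
      else ((1 / real CARD('n)) * (\<Sum>i\<in>UNIV. (B $ i) powr real_of_ereal q))
             powr (1 / real_of_ereal q))"

definition OPT :: "ereal \<Rightarrow> nat \<Rightarrow> (nat \<Rightarrow> real ^ 'n) \<Rightarrow> real" where
  "OPT q T b =
     (GREATEST v. \<exists>x :: nat \<Rightarrow> real ^ 'n. (\<forall>t\<in>{1..T}. x t \<in> std_simplex) \<and>
        v = holder_mean q (\<chi> i. \<Sum>t\<in>{1..T}. b t $ i * x t $ i))"

definition FLU ::
  "ereal \<Rightarrow> nat \<Rightarrow> nat \<Rightarrow> (nat \<Rightarrow> real) \<Rightarrow> (nat \<Rightarrow> real ^ 'n) \<Rightarrow> real" where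
  "FLU q T L p \<beta> =
     (GREATEST v. \<exists>\<xi> :: nat \<Rightarrow> real ^ 'n. (\<forall>l\<in>{1..L}. \<xi> l \<in> std_simplex) \<and>
        v = holder_mean q (\<chi> i. real T * (\<Sum>l\<in>{1..L}. p l * \<beta> l $ i * \<xi> l $ i)))"

end

theory Submission imports Defs begin

text \<open>Every Hoelder mean with exponent at most 1 is monotone, positively homogeneous and
  quasi-concave on the nonnegative orthant, hence superadditive there; this is Jensen's
  inequality for finite averages. Choose a maximiser \<open>x\<close> of the hindsight problem for every
  sequence of types and let \<open>\<xi> l\<close> be the average over \<open>t\<close> of the conditional expectation of
  \<open>x t\<close> given that period \<open>t\<close> has type \<open>l\<close>. Then \<open>\<xi>\<close> is feasible for the fluid problem, and its
  utility vector is the expectation of the hindsight utility vector. Both maxima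
  exist by continuity of the mean.\<close>

section \<open>Hoelder means: case forms, monotonicity and homogeneity\<close>

lemma holder_mean_minf: "holder_mean (-\<infinity>) B = Min (range (\<lambda>i. B $ i))"
  by (simp add: holder_mean_def)

lemma holder_mean_zero: "holder_mean 0 B = root CARD('n) (\<Prod>i\<in>UNIV. B $ i)"
  for B :: "real ^ 'n"
  by (simp add: holder_mean_def)

lemma holder_mean_pos:
  fixes B :: "real ^ 'n"
  assumes "0 < r"
  shows "holder_mean (ereal r) B = ((\<Sum>i\<in>UNIV. (B $ i) powr r) / real CARD('n)) powr (1 / r)"
  using assms by (simp add: holder_mean_def)

lemma holder_mean_neg:
  fixes B :: "real ^ 'n"
  assumes "r < 0"
  shows "holder_mean (ereal r) B =
    (if \<forall>i. 0 < B $ i then ((\<Sum>i\<in>UNIV. (B $ i) powr r) / real CARD('n)) powr (1 / r) else 0)"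
  using assms by (simp add: holder_mean_def)

lemma exponent_cases [consumes 1, case_names minf neg zero pos]:
  assumes "q \<le> (1::ereal)"
  obtains "q = -\<infinity>" | r where "q = ereal r" "r < 0" | "q = 0"
    | r where "q = ereal r" "0 < r" "r \<le> 1"
proof (cases q)
  case (real r)
  then show ?thesis
    using that assms by (cases r "0::real" rule: linorder_cases) (auto simp: zero_ereal_def)
qed (use that assms in auto)

lemma holder_mean_nonneg:
  assumes "q \<le> 1" "\<And>i. 0 \<le> B $ i"
  shows "0 \<le> holder_mean q B"
  using assms(1)
proof (cases rule: exponent_cases)
  case minf
  then show ?thesis using assms(2) by (auto simp: holder_mean_minf)
next
  case zero
  then show ?thesis using assms(2) by (auto simp: holder_mean_zero intro!: prod_nonneg)
qed (auto simp: holder_mean_pos holder_mean_neg)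

lemma holder_mean_mono:
  fixes A B :: "real ^ 'n"
  assumes "q \<le> 1" "\<And>i. 0 \<le> A $ i" "\<And>i. A $ i \<le> B $ i"
  shows "holder_mean q A \<le> holder_mean q B"
  using assms(1)
proof (cases rule: exponent_cases)
  case minf
  then show ?thesis using assms(3)
    by (auto simp: holder_mean_minf Min_le_iff intro: order_trans[OF Min_le])
next
  case zero
  then show ?thesis using assms(2,3)
    by (auto simp: holder_mean_zero intro!: prod_mono)
next
  case (pos r)
  then show ?thesis using assms(2,3)
    by (auto simp: holder_mean_pos intro!: powr_mono2 sum_mono divide_right_mono sum_nonneg divide_nonneg_nonneg)
next
  case (neg r)
  show ?thesis
  proof (cases "\<forall>i. 0 < A $ i")
    case True
    then have B: "\<forall>i. 0 < B $ i"
      using assms(3) less_le_trans by blast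
    \<comment> \<open>The inner power \<open>r\<close> reverses the order and the outer power
      \<open>1 / r\<close> restores it. Both exponents are negative, so both reversals rest on
      positive bases.\<close>
    have "0 < (\<Sum>i\<in>UNIV. (B $ i) powr r) / real CARD('n)"
      using B by (intro divide_pos_pos sum_pos) (auto simp: less_imp_neq[symmetric])
    moreover have "(\<Sum>i\<in>UNIV. (B $ i) powr r) \<le> (\<Sum>i\<in>UNIV. (A $ i) powr r)"
      using True neg assms(3) by (intro sum_mono powr_mono2') auto
    ultimately show ?thesis
      using True B neg by (auto simp: holder_mean_neg intro!: powr_mono2' divide_right_mono)
  qed (use neg in \<open>auto simp: holder_mean_neg\<close>)
qed

lemma holder_mean_scaleR:
  fixes B :: "real ^ 'n"
  assumes "q \<le> 1" "0 \<le> c" "\<And>i. 0 \<le> B $ i"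
  shows "holder_mean q (c *\<^sub>R B) = c * holder_mean q B"
  using assms(1)
proof (cases rule: exponent_cases)
  case minf
  have "mono (\<lambda>x. c * x)"
    using assms(2) by (auto intro!: monoI mult_left_mono)
  then have "c * Min (range (\<lambda>i. B $ i)) = Min ((\<lambda>x. c * x) ` range (\<lambda>i. B $ i))"
    by (rule mono_Min_commute) auto
  then show ?thesis using minf by (simp add: holder_mean_minf image_image)
next
  case zero
  then show ?thesis using assms(2)
    by (simp add: holder_mean_zero prod.distrib real_root_mult real_root_power_cancel)
next
  case (pos r)
  then have "(\<Sum>i\<in>UNIV. (c * B $ i) powr r) = c powr r * (\<Sum>i\<in>UNIV. (B $ i) powr r)"
    using assms by (simp add: powr_mult sum_distrib_left)
  then have "holder_mean q (c *\<^sub>R B) = (c powr r) powr (1 / r) * holder_mean q B"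
    using pos by (simp add: holder_mean_pos powr_mult sum_nonneg flip: times_divide_eq_right)
  then show ?thesis using pos assms(2) by (simp add: powr_powr)
next
  case (neg r)
  then have "(\<Sum>i\<in>UNIV. (c * B $ i) powr r) = c powr r * (\<Sum>i\<in>UNIV. (B $ i) powr r)"
    using assms by (simp add: powr_mult sum_distrib_left)
  \<comment> \<open>The power formula is the value of the scaled vector only if positivity of
    entries survives scaling. For \<open>c = 0\<close> the default value 0 of the mean is used
    below.\<close>
  then have "holder_mean q (c *\<^sub>R B) = (c powr r) powr (1 / r) * holder_mean q B" if "0 < c"
    using neg that
    by (simp add: holder_mean_neg powr_mult sum_nonneg zero_less_mult_iff flip: times_divide_eq_right)
  then show ?thesis using neg assms(2)
    by (cases "c = 0") (auto simp: holder_mean_neg powr_powr)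
qed

section \<open>Concavity of powers and superadditivity of the means\<close>

text \<open>The second derivative test works only in the open half-line. If one of the two points is
  0, the inequality reduces to \<open>u * y powr r \<le> (u * y) powr r\<close>, which holds because
  \<open>u \<le> u powr r\<close> for \<open>u\<close> in the unit interval and
  \<open>r \<le> 1\<close>.\<close>

lemma concave_on_powr:
  assumes "0 < r" "r \<le> (1::real)"
  shows "concave_on {0..} (\<lambda>x. x powr r)"
proof -
  have pos: "concave_on {0<..} (\<lambda>x. x powr r)"
  proof (rule f''_le0_imp_concave)
    show "((\<lambda>x. x powr r) has_real_derivative r * x powr (r - 1)) (at x)"
      "((\<lambda>x. r * x powr (r - 1)) has_real_derivative r * ((r - 1) * x powr (r - 1 - 1))) (at x)"
      if "x \<in> {0<..}" for x
      using that by (intro DERIV_cmult has_real_derivative_powr; simp)+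
    show "r * ((r - 1) * x powr (r - 1 - 1)) \<le> 0" for x
      using assms by (intro mult_nonneg_nonpos mult_nonpos_nonneg) auto
  qed simp
  have shrink: "u * y powr r \<le> (u * y) powr r" if "0 \<le> u" "u \<le> 1" "0 \<le> y" for u y :: real
  proof -
    have "u powr 1 \<le> u powr r"
      using assms that by (intro powr_mono') auto
    then show ?thesis
      using that by (simp add: powr_mult mult_right_mono)
  qed
  show ?thesis
    unfolding concave_on_iff
  proof (intro conjI ballI allI impI)
    fix x y u v :: real
    assume *: "x \<in> {0..}" "y \<in> {0..}" "0 \<le> u" "0 \<le> v" "u + v = 1"
    show "u * x powr r + v * y powr r \<le> (u *\<^sub>R x + v *\<^sub>R y) powr r"
    proof (cases "x = 0 \<or> y = 0")
      case True
      then show ?thesis using * shrink by auto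
    next
      case False
      then show ?thesis using * pos by (auto simp: concave_on_iff)
    qed
  qed auto
qed

lemma convex_on_powr_neg:
  assumes "r < (0::real)"
  shows "convex_on {0<..} (\<lambda>x. x powr r)"
proof (rule f''_ge0_imp_convex)
  show "((\<lambda>x. x powr r) has_real_derivative r * x powr (r - 1)) (at x)"
    "((\<lambda>x. r * x powr (r - 1)) has_real_derivative r * ((r - 1) * x powr (r - 1 - 1))) (at x)"
    if "x \<in> {0<..}" for x
    using that by (intro DERIV_cmult has_real_derivative_powr; simp)+
  show "0 \<le> r * ((r - 1) * x powr (r - 1 - 1))" for x
    using assms by (intro mult_nonpos_nonpos mult_nonpos_nonneg) auto
qed simp

text \<open>Only level 1 is treated, since homogeneity rescales any positive level to it. At this
  level the outer power or root drops out, leaving a condition on a minimum, a product or a sum of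
  powers that can be checked coordinatewise.\<close>

lemma holder_mean_quasiconcave:
  fixes A B :: "real ^ 'n"
  assumes q: "q \<le> 1" and A: "\<And>i. 0 \<le> A $ i" and B: "\<And>i. 0 \<le> B $ i"
    and w: "1 \<le> holder_mean q A" "1 \<le> holder_mean q B"
    and uv: "0 \<le> u" "0 \<le> v" "u + v = 1"
  shows "1 \<le> holder_mean q (u *\<^sub>R A + v *\<^sub>R B)"
  using q
proof (cases rule: exponent_cases)
  case minf
  have "1 \<le> u * A $ i + v * B $ i" for i
  proof -
    have "1 \<le> A $ i" "1 \<le> B $ i"
      using w minf by (auto simp: holder_mean_minf)
    then have "u * 1 + v * 1 \<le> u * A $ i + v * B $ i"
      using uv by (intro add_mono mult_left_mono) auto
    then show ?thesis using uv by simp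
  qed
  then show ?thesis using minf by (simp add: holder_mean_minf)
next
  case zero
  \<comment> \<open>A product of at least 1 excludes zero entries, so the weighted AM-GM inequality
    applies in each coordinate; multiplying over the coordinates gives the claim.\<close>
  have prod_ge: "1 \<le> (\<Prod>i\<in>UNIV. A $ i)" "1 \<le> (\<Prod>i\<in>UNIV. B $ i)"
    using w zero by (auto simp: holder_mean_zero)
  then have "(\<Prod>i\<in>UNIV. A $ i) \<noteq> 0" "(\<Prod>i\<in>UNIV. B $ i) \<noteq> 0"
    by linarith+
  then have pos: "0 < A $ i" "0 < B $ i" for i
    using A[of i] B[of i] by (auto simp: less_le dest: spec[of _ i])
  have "1 * 1 \<le> (\<Prod>i\<in>UNIV. A $ i) powr u * (\<Prod>i\<in>UNIV. B $ i) powr v"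
    using prod_ge uv by (intro mult_mono ge_one_powr_ge_zero) auto
  also have "\<dots> = (\<Prod>i\<in>UNIV. (A $ i) powr u * (B $ i) powr v)"
    using A B by (simp add: prod_powr_distrib prod.distrib)
  also have "\<dots> \<le> (\<Prod>i\<in>UNIV. u * A $ i + v * B $ i)"
    using pos uv by (intro prod_mono conjI Youngs_inequality_0) auto
  finally show ?thesis using zero by (simp add: holder_mean_zero)
next
  case (pos r)
  have *: "1 \<le> holder_mean (ereal r) C \<longleftrightarrow> real CARD('n) \<le> (\<Sum>i\<in>UNIV. (C $ i) powr r)"
    for C :: "real ^ 'n"
  proof -
    have "1 powr (1/r) \<le> x powr (1/r) \<longleftrightarrow> 1 \<le> x" if "0 \<le> x" for x
      using pos that powr_mono2[of "1/r" 1 x] powr_less_mono2[of "1/r" x 1] by (auto simp: not_less[symmetric])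
    from this[of "(\<Sum>i\<in>UNIV. (C $ i) powr r) / real CARD('n)"]
    show ?thesis using pos by (simp add: holder_mean_pos sum_nonneg field_simps)
  qed
  have "real CARD('n) = u * real CARD('n) + v * real CARD('n)"
    using uv by (simp flip: distrib_right)
  also have "\<dots> \<le> u * (\<Sum>i\<in>UNIV. (A $ i) powr r) + v * (\<Sum>i\<in>UNIV. (B $ i) powr r)"
    using w pos uv by (intro add_mono mult_left_mono) (auto simp: *)
  also have "\<dots> = (\<Sum>i\<in>UNIV. u * (A $ i) powr r + v * (B $ i) powr r)"
    by (simp add: sum.distrib sum_distrib_left)
  also have "\<dots> \<le> (\<Sum>i\<in>UNIV. (u * A $ i + v * B $ i) powr r)"
    using concave_on_powr[of r] pos A B uv by (intro sum_mono) (auto simp: concave_on_iff)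
  finally show ?thesis using pos by (simp add: *)
next
  case (neg r)
  \<comment> \<open>The negative outer exponent turns the superlevel set of the mean into a sublevel
    set of the power sum, so convexity of \<open>x powr r\<close> takes the place of concavity.
    Vectors with a vanishing entry have mean 0 and drop out.\<close>
  have *: "1 \<le> holder_mean (ereal r) C \<longleftrightarrow>
      (\<forall>i. 0 < C $ i) \<and> (\<Sum>i\<in>UNIV. (C $ i) powr r) \<le> real CARD('n)"
    for C :: "real ^ 'n"
  proof (cases "\<forall>i. 0 < C $ i")
    case True
    then have "0 < (\<Sum>i\<in>UNIV. (C $ i) powr r) / real CARD('n)"
      by (intro divide_pos_pos sum_pos) (auto simp: less_imp_neq[symmetric])
    moreover have "1 powr (1/r) \<le> x powr (1/r) \<longleftrightarrow> x \<le> 1" if "0 < x" for x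
    proof
      assume "x \<le> 1"
      then show "1 powr (1/r) \<le> x powr (1/r)" using neg that by (intro powr_mono2') auto
    next
      assume "1 powr (1/r) \<le> x powr (1/r)"
      then show "x \<le> 1"
        using neg powr_less_mono2_neg[of "1/r" 1 x] by (auto simp: not_less[symmetric])
    qed
    ultimately show ?thesis using neg True by (auto simp: holder_mean_neg field_simps)
  qed (use neg in \<open>auto simp: holder_mean_neg\<close>)
  have pos: "0 < A $ i" "0 < B $ i" for i
    using w neg by (auto simp: *)
  have "(\<Sum>i\<in>UNIV. (u * A $ i + v * B $ i) powr r)
      \<le> (\<Sum>i\<in>UNIV. u * (A $ i) powr r + v * (B $ i) powr r)"
    using convex_on_powr_neg[of r] neg pos uv by (intro sum_mono) (auto simp: convex_on_def)
  also have "\<dots> = u * (\<Sum>i\<in>UNIV. (A $ i) powr r) + v * (\<Sum>i\<in>UNIV. (B $ i) powr r)"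
    by (simp add: sum.distrib sum_distrib_left)
  also have "\<dots> \<le> u * real CARD('n) + v * real CARD('n)"
    using w neg uv by (intro add_mono mult_left_mono) (auto simp: *)
  also have "\<dots> = real CARD('n)"
    using uv by (simp flip: distrib_right)
  finally have "(\<Sum>i\<in>UNIV. (u * A $ i + v * B $ i) powr r) \<le> real CARD('n)" .
  moreover have "0 < u * A $ i + v * B $ i" for i
    using convex_on_imp_convex[OF convex_on_powr_neg[OF \<open>r < 0\<close>]] pos[of i] uv
    unfolding convex_def by force
  ultimately show ?thesis using neg by (simp add: *)
qed

text \<open>If both means \<open>a\<close> and \<open>b\<close> are positive,
  \<open>(1 / a) *\<^sub>R A\<close> and \<open>(1 / b) *\<^sub>R B\<close> have mean 1, and
  \<open>A + B\<close> is \<open>a + b\<close> times their convex combination with weights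
  \<open>a / (a + b)\<close> and \<open>b / (a + b)\<close>. If one mean vanishes, monotonicity
  suffices.\<close>

lemma holder_mean_superadditive:
  fixes A B :: "real ^ 'n"
  assumes q: "q \<le> 1" and A: "\<And>i. 0 \<le> A $ i" and B: "\<And>i. 0 \<le> B $ i"
  shows "holder_mean q A + holder_mean q B \<le> holder_mean q (A + B)"
proof -
  define a b where "a = holder_mean q A" and "b = holder_mean q B"
  have nonneg: "0 \<le> a" "0 \<le> b"
    using assms by (auto simp: a_def b_def intro: holder_mean_nonneg)
  consider "a = 0" | "b = 0" | "0 < a" "0 < b"
    using nonneg by linarith
  then show ?thesis
  proof cases
    case 1
    then show ?thesis
      using holder_mean_mono[OF q, of B "A + B"] A B by (simp add: a_def)
  next
    case 2
    then show ?thesis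
      using holder_mean_mono[OF q, of A "A + B"] A B by (simp add: b_def)
  next
    case 3
    define C where "C = (a / (a + b)) *\<^sub>R ((1 / a) *\<^sub>R A) + (b / (a + b)) *\<^sub>R ((1 / b) *\<^sub>R B)"
    have "1 \<le> holder_mean q C"
      unfolding C_def
    proof (rule holder_mean_quasiconcave[OF q])
      show "1 \<le> holder_mean q ((1 / a) *\<^sub>R A)" "1 \<le> holder_mean q ((1 / b) *\<^sub>R B)"
        using 3 A B q by (simp_all add: holder_mean_scaleR flip: a_def b_def)
    qed (use 3 A B in \<open>auto simp: add_divide_distrib[symmetric]\<close>)
    moreover have "0 \<le> C $ i" for i
      using 3 A B by (auto simp: C_def)
    moreover have "A + B = (a + b) *\<^sub>R C"
      using 3 by (simp add: C_def scaleR_add_right)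
    ultimately show ?thesis
      using 3 q by (simp add: holder_mean_scaleR flip: a_def b_def)
  qed
qed

text \<open>Jensen's inequality: homogeneity moves each weight inside the mean, and superadditivity
  merges the terms one at a time.\<close>

lemma holder_mean_sum_ge:
  fixes B :: "'k \<Rightarrow> real ^ 'n"
  assumes q: "q \<le> 1" and "finite K" and "\<And>k. k \<in> K \<Longrightarrow> 0 \<le> c k"
    and "\<And>k i. k \<in> K \<Longrightarrow> 0 \<le> B k $ i"
  shows "(\<Sum>k\<in>K. c k * holder_mean q (B k)) \<le> holder_mean q (\<Sum>k\<in>K. c k *\<^sub>R B k)"
  using assms(2-)
proof (induction K rule: finite_induct)
  case empty
  then show ?case by (simp add: holder_mean_nonneg[OF q])
next
  case (insert k K)
  have "c k * holder_mean q (B k) + (\<Sum>k\<in>K. c k * holder_mean q (B k))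
      \<le> holder_mean q (c k *\<^sub>R B k) + holder_mean q (\<Sum>k\<in>K. c k *\<^sub>R B k)"
    using insert q by (simp add: holder_mean_scaleR)
  also have "\<dots> \<le> holder_mean q (c k *\<^sub>R B k + (\<Sum>k\<in>K. c k *\<^sub>R B k))"
    using insert.prems by (intro holder_mean_superadditive q) (auto intro!: sum_nonneg)
  finally show ?case using insert by simp
qed

section \<open>Continuity of the means\<close>

lemma continuous_on_Min_image:
  fixes f :: "'i \<Rightarrow> 'a::topological_space \<Rightarrow> 'b::linorder_topology"
  assumes "finite I" "I \<noteq> {}" "\<And>i. i \<in> I \<Longrightarrow> continuous_on S (f i)"
  shows "continuous_on S (\<lambda>x. Min ((\<lambda>i. f i x) ` I))"
  using assms by (induction I rule: finite_ne_induct) (auto intro: continuous_on_min)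

text \<open>The delicate case is a negative exponent. Near a vector with positive entries the power
  formula is valid and continuous; at a vector with a zero entry \<open>j\<close> the mean is
  squeezed between 0 and a multiple of the \<open>j\<close>-th entry.\<close>

lemma continuous_on_holder_mean:
  assumes "q \<le> 1"
  shows "continuous_on {B :: real ^ 'n. \<forall>i. 0 \<le> B $ i} (holder_mean q)"
  using assms
proof (cases rule: exponent_cases)
  case minf
  then show ?thesis
    by (auto simp: holder_mean_minf intro!: continuous_on_Min_image continuous_intros)
next
  case zero
  then show ?thesis
    by (auto simp: holder_mean_zero intro!: continuous_intros)
next
  case (pos r)
  have "continuous_on {B. \<forall>i. 0 \<le> B $ i}
      (\<lambda>B :: real ^ 'n. ((\<Sum>i\<in>UNIV. (B $ i) powr r) / real CARD('n)) powr (1 / r))"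
    by (intro continuous_on_powr' continuous_on_divide continuous_on_sum continuous_intros)
      (use pos in \<open>auto intro!: sum_nonneg divide_nonneg_nonneg\<close>)
  then show ?thesis using pos by (simp add: holder_mean_pos)
next
  case (neg r)
  let ?S = "{B :: real ^ 'n. \<forall>i. 0 \<le> B $ i}"
  let ?f = "\<lambda>B :: real ^ 'n. ((\<Sum>i\<in>UNIV. (B $ i) powr r) / real CARD('n)) powr (1 / r)"
  have "(holder_mean q \<longlongrightarrow> holder_mean q C) (at C within ?S)" if C: "C \<in> ?S" for C
  proof (cases "\<forall>i. 0 < C $ i")
    case True
    have "\<forall>\<^sub>F B in at C within ?S. 0 < B $ i" for i
      using True by (intro order_tendstoD(1)[of _ "C $ i"] tendsto_intros) auto
    then have "\<forall>\<^sub>F B in at C within ?S. \<forall>i. 0 < B $ i"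
      by (simp add: eventually_all_finite)
    then have ev: "\<forall>\<^sub>F B in at C within ?S. ?f B = holder_mean q B"
      by eventually_elim (use neg in \<open>simp add: holder_mean_neg\<close>)
    have "(\<Sum>i\<in>UNIV. (C $ i) powr r) / real CARD('n) \<noteq> 0"
      using True by (auto simp: sum_nonneg_eq_0_iff less_imp_neq[symmetric])
    then have "(?f \<longlongrightarrow> ?f C) (at C within ?S)"
      using True by (intro tendsto_intros) (auto simp: less_imp_neq[symmetric])
    then have "(holder_mean q \<longlongrightarrow> ?f C) (at C within ?S)"
      using ev by (rule Lim_transform_eventually)
    moreover have "holder_mean q C = ?f C"
      using True neg by (simp add: holder_mean_neg)
    ultimately show ?thesis by simp
  next
    case False
    with C obtain j where j: "C $ j = 0"
      by (auto simp: not_less intro: order_antisym)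
    \<comment> \<open>This constant arises from keeping only the \<open>j\<close>-th term of the
      power sum. As \<open>1 / r\<close> is negative, dropping the other terms can only increase the
      value.\<close>
    let ?c = "(1 / real CARD('n)) powr (1 / r)"
    have bound: "holder_mean q B \<le> ?c * B $ j" if "B \<in> ?S" for B
    proof (cases "\<forall>i. 0 < B $ i")
      case True
      have "(B $ j) powr r \<le> (\<Sum>i\<in>UNIV. (B $ i) powr r)"
        by (rule member_le_sum) auto
      then have "?f B \<le> ((B $ j) powr r / real CARD('n)) powr (1 / r)"
        using neg True by (intro powr_mono2' divide_right_mono divide_pos_pos) (auto simp: less_imp_neq[symmetric])
      also have "\<dots> = ((1 / real CARD('n)) * (B $ j) powr r) powr (1 / r)"
        by simp
      also have "\<dots> = ?c * B $ j"
        using neg True by (subst powr_mult) (auto simp: powr_powr less_imp_le)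
      finally show ?thesis using neg True by (simp add: holder_mean_neg)
    qed (use neg that in \<open>auto simp: holder_mean_neg\<close>)
    have "((\<lambda>B. ?c * B $ j) \<longlongrightarrow> ?c * C $ j) (at C within ?S)"
      by (intro tendsto_intros)
    then have "((\<lambda>B. ?c * B $ j) \<longlongrightarrow> 0) (at C within ?S)"
      using j by simp
    then have "(holder_mean q \<longlongrightarrow> 0) (at C within ?S)"
      by (rule tendsto_sandwich[OF _ _ tendsto_const, rotated 2])
        (use bound assms in \<open>auto simp: eventually_at_filter intro!: always_eventually holder_mean_nonneg\<close>)
    moreover have "holder_mean q C = 0"
      using False neg by (auto simp: holder_mean_neg)
    ultimately show ?thesis by simp
  qed
  then show ?thesis by (simp add: continuous_on_def)
qed

section \<open>Compactness and existence of maximisers\<close>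

lemma compact_std_simplex: "compact (std_simplex :: (real ^ 'n) set)"
proof -
  have "closed {x :: real ^ 'n. \<forall>i. 0 \<le> x $ i}"
    by (intro closed_Collect_all closed_Collect_le continuous_intros)
  moreover have "closed {x :: real ^ 'n. (\<Sum>i\<in>UNIV. x $ i) = 1}"
    by (intro closed_Collect_eq continuous_intros)
  ultimately have "closed (std_simplex :: (real ^ 'n) set)"
    unfolding std_simplex_def by (rule closed_Collect_conj)
  moreover have "norm x \<le> 1" if "x \<in> std_simplex" for x :: "real ^ 'n"
    using that norm_le_l1_cart[of x] by (simp add: std_simplex_def)
  then have "bounded (std_simplex :: (real ^ 'n) set)"
    by (auto intro: boundedI)
  ultimately show ?thesis by (simp add: compact_eq_bounded_closed)
qed

lemma axis_in_std_simplex: "axis k 1 \<in> std_simplex"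
  by (simp add: std_simplex_def axis_def)

text \<open>The attainable utility vectors form a Minkowski sum of linear images of
  \<open>S\<close>, one for each index. Working with these vectors keeps the compactness argument in
  finite dimension instead of a space of allocation functions.\<close>

lemma compact_weighted_allocations:
  fixes c :: "'l \<Rightarrow> real ^ 'n"
  assumes "finite I" "compact S"
  shows "compact {(\<chi> i. \<Sum>l\<in>I. c l $ i * x l $ i) | x. \<forall>l\<in>I. x l \<in> S}"
  using assms(1)
proof (induction I rule: finite_induct)
  case empty
  show ?case by simp
next
  case (insert l I)
  let ?V = "\<lambda>I. {(\<chi> i. \<Sum>l\<in>I. c l $ i * x l $ i) | x. \<forall>l\<in>I. x l \<in> S}"
  let ?g = "\<lambda>y :: real ^ 'n. \<chi> i. c l $ i * y $ i"
  have "?V (insert l I) = {u + v | u v. u \<in> ?g ` S \<and> v \<in> ?V I}"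
  proof (intro equalityI subsetI)
    fix z assume "z \<in> ?V (insert l I)"
    then obtain x where x: "\<forall>l\<in>insert l I. x l \<in> S"
      and z: "z = (\<chi> i. \<Sum>l\<in>insert l I. c l $ i * x l $ i)" by blast
    have "z = ?g (x l) + (\<chi> i. \<Sum>l\<in>I. c l $ i * x l $ i)"
      using insert.hyps by (simp add: z vec_eq_iff)
    moreover have "?g (x l) \<in> ?g ` S" using x by blast
    moreover have "(\<chi> i. \<Sum>l\<in>I. c l $ i * x l $ i) \<in> ?V I" using x by blast
    ultimately show "z \<in> {u + v | u v. u \<in> ?g ` S \<and> v \<in> ?V I}" by blast
  next
    fix z assume "z \<in> {u + v | u v. u \<in> ?g ` S \<and> v \<in> ?V I}"
    then obtain y x where y: "y \<in> S" and x: "\<forall>l\<in>I. x l \<in> S"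
      and z: "z = ?g y + (\<chi> i. \<Sum>l\<in>I. c l $ i * x l $ i)" by blast
    \<comment> \<open>The two independent choices are joined by overwriting \<open>x\<close> at
      \<open>l\<close>; since \<open>l\<close> is not in \<open>I\<close>, the old sum is
      unaffected.\<close>
    have "(\<Sum>k\<in>I. c k $ i * (x(l := y)) k $ i) = (\<Sum>k\<in>I. c k $ i * x k $ i)" for i
      using insert.hyps by (intro sum.cong) auto
    then have "z = (\<chi> i. \<Sum>k\<in>insert l I. c k $ i * (x(l := y)) k $ i)"
      using insert.hyps by (simp add: z vec_eq_iff)
    moreover have "\<forall>k\<in>insert l I. (x(l := y)) k \<in> S" using x y by auto
    ultimately show "z \<in> ?V (insert l I)" by (intro CollectI exI conjI)
  qed
  moreover have "compact (?g ` S)"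
    by (intro compact_continuous_image assms(2) continuous_on_vec_lambda continuous_intros)
  then have "compact {u + v | u v. u \<in> ?g ` S \<and> v \<in> ?V I}"
    using insert.IH by (rule compact_sums)
  ultimately show ?case by (simp only:)
qed

text \<open>A continuous function on a nonempty compact set has a maximum. The coefficients
  \<open>c\<close> are general so that one statement covers both the hindsight problem, indexed by
  periods, and the fluid problem, indexed by types.\<close>

lemma holder_mean_attains_max:
  fixes c :: "'l \<Rightarrow> real ^ 'n"
  assumes q: "q \<le> 1" and "finite I" and c: "\<And>l i. l \<in> I \<Longrightarrow> 0 \<le> c l $ i"
  shows "\<exists>x. (\<forall>l\<in>I. x l \<in> std_simplex) \<and> (\<forall>y. (\<forall>l\<in>I. y l \<in> std_simplex) \<longrightarrow>
      holder_mean q (\<chi> i. \<Sum>l\<in>I. c l $ i * y l $ i)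
        \<le> holder_mean q (\<chi> i. \<Sum>l\<in>I. c l $ i * x l $ i))"
proof -
  let ?V = "{(\<chi> i. \<Sum>l\<in>I. c l $ i * x l $ i) | x. \<forall>l\<in>I. x l \<in> std_simplex}"
  have "?V \<subseteq> {B. \<forall>i. 0 \<le> B $ i}"
    using c by (auto simp: std_simplex_def intro!: sum_nonneg)
  with continuous_on_holder_mean[OF q] have "continuous_on ?V (holder_mean q)"
    by (rule continuous_on_subset)
  \<comment> \<open>Nonemptiness: everything goes to one fixed agent, and \<open>undefined\<close>
    just names some agent.\<close>
  moreover have "(\<chi> i. \<Sum>l\<in>I. c l $ i * axis undefined 1 $ i) \<in> ?V"
    by (intro CollectI exI[of _ "\<lambda>_. axis undefined 1"] conjI refl ballI axis_in_std_simplex)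
  then have "?V \<noteq> {}" by (metis empty_iff)
  moreover have "compact ?V"
    by (intro compact_weighted_allocations compact_std_simplex assms)
  ultimately have "\<exists>z\<in>?V. \<forall>y\<in>?V. holder_mean q y \<le> holder_mean q z"
    by (intro continuous_attains_sup)
  then obtain z where z: "z \<in> ?V" and max: "\<And>y. y \<in> ?V \<Longrightarrow> holder_mean q y \<le> holder_mean q z"
    by blast
  from z obtain x where x: "\<forall>l\<in>I. x l \<in> std_simplex"
    and zx: "z = (\<chi> i. \<Sum>l\<in>I. c l $ i * x l $ i)" by blast
  show ?thesis
  proof (intro exI[of _ x] conjI x allI impI)
    fix y :: "'l \<Rightarrow> real ^ 'n"
    assume "\<forall>l\<in>I. y l \<in> std_simplex"
    then have "(\<chi> i. \<Sum>l\<in>I. c l $ i * y l $ i) \<in> ?V"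
      by (intro CollectI exI[of _ y] conjI refl)
    then show "holder_mean q (\<chi> i. \<Sum>l\<in>I. c l $ i * y l $ i)
        \<le> holder_mean q (\<chi> i. \<Sum>l\<in>I. c l $ i * x l $ i)"
      unfolding zx[symmetric] by (rule max)
  qed
qed

section \<open>The hindsight and fluid optima\<close>

text \<open>\<open>GREATEST\<close> denotes the maximum only when a greatest value exists, so a
  maximiser must be exhibited before \<open>OPT\<close> can be used.\<close>

lemma OPT_attained:
  fixes b :: "nat \<Rightarrow> real ^ 'n"
  assumes "q \<le> 1" and "\<And>t i. t \<in> {1..T} \<Longrightarrow> 0 \<le> b t $ i"
  shows "\<exists>x. (\<forall>t\<in>{1..T}. x t \<in> std_simplex) \<and>
    OPT q T b = holder_mean q (\<chi> i. \<Sum>t\<in>{1..T}. b t $ i * x t $ i)"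
proof -
  obtain x where x: "\<forall>t\<in>{1..T}. x t \<in> std_simplex"
    and max: "\<forall>y. (\<forall>t\<in>{1..T}. y t \<in> std_simplex) \<longrightarrow>
      holder_mean q (\<chi> i. \<Sum>t\<in>{1..T}. b t $ i * y t $ i)
        \<le> holder_mean q (\<chi> i. \<Sum>t\<in>{1..T}. b t $ i * x t $ i)"
    using holder_mean_attains_max[OF assms(1) finite_atLeastAtMost, of 1 T b] assms(2) by blast
  have "OPT q T b = holder_mean q (\<chi> i. \<Sum>t\<in>{1..T}. b t $ i * x t $ i)"
    unfolding OPT_def
  proof (rule Greatest_equality)
    show "v \<le> holder_mean q (\<chi> i. \<Sum>t\<in>{1..T}. b t $ i * x t $ i)"
      if "\<exists>x. (\<forall>t\<in>{1..T}. x t \<in> std_simplex) \<and>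
        v = holder_mean q (\<chi> i. \<Sum>t\<in>{1..T}. b t $ i * x t $ i)" for v
      using max that by blast
  qed (use x in blast)
  with x show ?thesis by blast
qed

lemma OPT_nonneg:
  assumes "q \<le> 1" and "\<And>t i. t \<in> {1..T} \<Longrightarrow> 0 \<le> b t $ i"
  shows "0 \<le> OPT q T b"
proof -
  obtain x where "\<forall>t\<in>{1..T}. x t \<in> std_simplex"
    and "OPT q T b = holder_mean q (\<chi> i. \<Sum>t\<in>{1..T}. b t $ i * x t $ i)"
    using OPT_attained[OF assms(1), of T b] assms(2) by blast
  then show ?thesis
    using assms by (auto simp: std_simplex_def intro!: holder_mean_nonneg sum_nonneg)
qed

lemma OPT_cong:
  assumes "\<And>t. t \<in> {1..T} \<Longrightarrow> b t = b' t"
  shows "OPT q T b = OPT q T b'"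
proof -
  have "(\<chi> i. \<Sum>t\<in>{1..T}. b t $ i * x t $ i) = (\<chi> i. \<Sum>t\<in>{1..T}. b' t $ i * x t $ i)" for x
    using assms by (simp add: vec_eq_iff)
  then show ?thesis by (simp add: OPT_def)
qed

lemma FLU_ge:
  fixes \<beta> :: "nat \<Rightarrow> real ^ 'n"
  assumes q: "q \<le> 1" and p: "\<And>l. l \<in> {1..L} \<Longrightarrow> 0 \<le> p l"
    and \<beta>: "\<And>l i. l \<in> {1..L} \<Longrightarrow> 0 \<le> \<beta> l $ i"
    and \<xi>: "\<And>l. l \<in> {1..L} \<Longrightarrow> \<xi> l \<in> std_simplex"
  shows "holder_mean q (\<chi> i. real T * (\<Sum>l\<in>{1..L}. p l * \<beta> l $ i * \<xi> l $ i)) \<le> FLU q T L p \<beta>"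
proof -
  \<comment> \<open>Absorbing the horizon and the type mass into the coefficients gives the fluid
    objective the form of the general maximisation problem.\<close>
  define c where "c l = (real T * p l) *\<^sub>R \<beta> l" for l
  have c: "real T * (\<Sum>l\<in>{1..L}. p l * \<beta> l $ i * \<xi> l $ i) = (\<Sum>l\<in>{1..L}. c l $ i * \<xi> l $ i)"
    for i \<xi> by (simp add: c_def sum_distrib_left mult_ac)
  have "0 \<le> c l $ i" if "l \<in> {1..L}" for l i
    using p[OF that] \<beta>[OF that] by (simp add: c_def)
  then obtain x where x: "\<forall>l\<in>{1..L}. x l \<in> std_simplex"
    and max: "\<forall>y. (\<forall>l\<in>{1..L}. y l \<in> std_simplex) \<longrightarrow>
      holder_mean q (\<chi> i. \<Sum>l\<in>{1..L}. c l $ i * y l $ i)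
        \<le> holder_mean q (\<chi> i. \<Sum>l\<in>{1..L}. c l $ i * x l $ i)"
    using holder_mean_attains_max[OF q finite_atLeastAtMost, of 1 L c] by blast
  have "FLU q T L p \<beta> = holder_mean q (\<chi> i. \<Sum>l\<in>{1..L}. c l $ i * x l $ i)"
    unfolding FLU_def c
  proof (rule Greatest_equality)
    show "v \<le> holder_mean q (\<chi> i. \<Sum>l\<in>{1..L}. c l $ i * x l $ i)"
      if "\<exists>\<xi>. (\<forall>l\<in>{1..L}. \<xi> l \<in> std_simplex) \<and>
        v = holder_mean q (\<chi> i. \<Sum>l\<in>{1..L}. c l $ i * \<xi> l $ i)" for v
      using max that by blast
  qed (use x in blast)
  moreover have "holder_mean q (\<chi> i. \<Sum>l\<in>{1..L}. c l $ i * \<xi> l $ i)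
      \<le> holder_mean q (\<chi> i. \<Sum>l\<in>{1..L}. c l $ i * x l $ i)"
    using max \<xi> by blast
  ultimately show ?thesis by (simp only: c)
qed

section \<open>Averaging hindsight allocations into a fluid allocation\<close>

text \<open>The probability-free core: \<open>K\<close> is a finite set of type sequences,
  \<open>W\<close> weights them like a law, and \<open>marginal\<close> says that each period has
  type \<open>l\<close> with weight \<open>p l\<close>.\<close>

lemma sum_OPT_le_FLU:
  fixes \<beta> :: "nat \<Rightarrow> real ^ 'n" and K :: "(nat \<Rightarrow> nat) set"
  assumes q: "q \<le> 1" and T: "1 \<le> T"
    and p: "\<And>l. l \<in> {1..L} \<Longrightarrow> 0 < p l"
    and \<beta>: "\<And>l i. l \<in> {1..L} \<Longrightarrow> 0 \<le> \<beta> l $ i"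
    and K: "finite K" "\<And>k t. k \<in> K \<Longrightarrow> t \<in> {1..T} \<Longrightarrow> k t \<in> {1..L}"
    and W: "\<And>k. k \<in> K \<Longrightarrow> 0 \<le> W k"
    and marginal: "\<And>t l. t \<in> {1..T} \<Longrightarrow> l \<in> {1..L} \<Longrightarrow> (\<Sum>k\<in>{k \<in> K. k t = l}. W k) = p l"
  shows "(\<Sum>k\<in>K. W k * OPT q T (\<lambda>t. \<beta> (k t))) \<le> FLU q T L p \<beta>"
proof -
  have "\<forall>k\<in>K. \<exists>x. (\<forall>t\<in>{1..T}. x t \<in> std_simplex) \<and>
      OPT q T (\<lambda>t. \<beta> (k t)) = holder_mean q (\<chi> i. \<Sum>t\<in>{1..T}. \<beta> (k t) $ i * x t $ i)"
    using K(2) \<beta> by (intro ballI OPT_attained q) blast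
  from bchoice[OF this] obtain x where
    x: "\<And>k t. k \<in> K \<Longrightarrow> t \<in> {1..T} \<Longrightarrow> x k t \<in> std_simplex" and
    opt: "\<And>k. k \<in> K \<Longrightarrow>
      OPT q T (\<lambda>t. \<beta> (k t)) = holder_mean q (\<chi> i. \<Sum>t\<in>{1..T}. \<beta> (k t) $ i * x k t $ i)"
    by blast
  \<comment> \<open>The denominator \<open>T * p l\<close> is the total weight of the pairs
    \<open>(k, t)\<close> with \<open>k t = l\<close>, so \<open>\<xi> l\<close> is a weighted
    average of points of the simplex.\<close>
  define \<xi> :: "nat \<Rightarrow> real ^ 'n" where
    "\<xi> l = (\<chi> i. (\<Sum>k\<in>K. \<Sum>t\<in>{1..T}. if k t = l then W k * x k t $ i else 0) / (real T * p l))" for l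
  have \<xi>: "\<xi> l \<in> std_simplex" if l: "l \<in> {1..L}" for l
  proof -
    have "(\<Sum>i\<in>UNIV. \<Sum>k\<in>K. \<Sum>t\<in>{1..T}. if k t = l then W k * x k t $ i else 0)
        = (\<Sum>k\<in>K. \<Sum>t\<in>{1..T}. \<Sum>i\<in>UNIV. if k t = l then W k * x k t $ i else 0)"
      by (rule trans[OF sum.swap sum.cong[OF refl sum.swap]])
    also have "\<dots> = (\<Sum>k\<in>K. \<Sum>t\<in>{1..T}. if k t = l then W k else 0)"
      using x by (intro sum.cong) (auto simp: std_simplex_def simp flip: sum_distrib_left)
    also have "\<dots> = (\<Sum>t\<in>{1..T}. \<Sum>k\<in>{k \<in> K. k t = l}. W k)"
      using K(1) by (subst sum.swap) (simp add: sum.inter_filter)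
    also have "\<dots> = real T * p l"
      using marginal l by simp
    finally have "(\<Sum>i\<in>UNIV. \<xi> l $ i) = 1"
      using T p[OF l] by (simp add: \<xi>_def flip: sum_divide_distrib)
    moreover have "0 \<le> \<xi> l $ i" for i
      using T p[OF l] W x by (auto simp: \<xi>_def std_simplex_def intro!: sum_nonneg divide_nonneg_nonneg)
    ultimately show ?thesis by (simp add: std_simplex_def)
  qed
  have fluid: "(\<Sum>k\<in>K. W k *\<^sub>R (\<chi> i. \<Sum>t\<in>{1..T}. \<beta> (k t) $ i * x k t $ i))
      = (\<chi> i. real T * (\<Sum>l\<in>{1..L}. p l * \<beta> l $ i * \<xi> l $ i))"
  proof (rule vec_eq_iff[THEN iffD2], rule allI)
    fix i
    have "real T * (\<Sum>l\<in>{1..L}. p l * \<beta> l $ i * \<xi> l $ i)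
        = (\<Sum>l\<in>{1..L}. \<beta> l $ i * (real T * p l * \<xi> l $ i))"
      by (simp add: sum_distrib_left mult_ac)
    also have "\<dots> = (\<Sum>l\<in>{1..L}. \<beta> l $ i *
        (\<Sum>k\<in>K. \<Sum>t\<in>{1..T}. if k t = l then W k * x k t $ i else 0))"
    proof (rule sum.cong[OF refl])
      fix l assume "l \<in> {1..L}"
      then have "real T * p l \<noteq> 0" using T p by force
      then show "\<beta> l $ i * (real T * p l * \<xi> l $ i) = \<beta> l $ i *
          (\<Sum>k\<in>K. \<Sum>t\<in>{1..T}. if k t = l then W k * x k t $ i else 0)"
        by (simp add: \<xi>_def)
    qed
    \<comment> \<open>Under the condition \<open>k t = l\<close> one may write
      \<open>\<beta> (k t)\<close> for \<open>\<beta> l\<close>. After the exchange of sums, the sum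
      over \<open>l\<close> then has exactly one active term, because \<open>k t\<close> lies in
      \<open>{1..L}\<close>.\<close>
    also have "\<dots> = (\<Sum>l\<in>{1..L}. \<Sum>k\<in>K. \<Sum>t\<in>{1..T}.
        if k t = l then \<beta> (k t) $ i * (W k * x k t $ i) else 0)"
      by (auto simp: sum_distrib_left intro!: sum.cong)
    also have "\<dots> = (\<Sum>k\<in>K. \<Sum>t\<in>{1..T}. \<Sum>l\<in>{1..L}.
        if k t = l then \<beta> (k t) $ i * (W k * x k t $ i) else 0)"
      by (rule trans[OF sum.swap sum.cong[OF refl sum.swap]])
    also have "\<dots> = (\<Sum>k\<in>K. \<Sum>t\<in>{1..T}. \<beta> (k t) $ i * (W k * x k t $ i))"
      using K(2) by (intro sum.cong refl) (simp add: sum.delta)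
    finally show "(\<Sum>k\<in>K. W k *\<^sub>R (\<chi> i. \<Sum>t\<in>{1..T}. \<beta> (k t) $ i * x k t $ i)) $ i
      = (\<chi> i. real T * (\<Sum>l\<in>{1..L}. p l * \<beta> l $ i * \<xi> l $ i)) $ i"
      by (simp add: sum_distrib_left mult_ac)
  qed
  have "(\<Sum>k\<in>K. W k * OPT q T (\<lambda>t. \<beta> (k t)))
      = (\<Sum>k\<in>K. W k * holder_mean q (\<chi> i. \<Sum>t\<in>{1..T}. \<beta> (k t) $ i * x k t $ i))"
    by (simp add: opt)
  also have "\<dots> \<le> holder_mean q (\<Sum>k\<in>K. W k *\<^sub>R (\<chi> i. \<Sum>t\<in>{1..T}. \<beta> (k t) $ i * x k t $ i))"
    using q K W \<beta> x
    by (intro holder_mean_sum_ge) (auto simp: std_simplex_def intro!: sum_nonneg mult_nonneg_nonneg)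
  also have "\<dots> \<le> FLU q T L p \<beta>"
    unfolding fluid using p by (intro FLU_ge q \<beta> \<xi>) (auto intro: less_imp_le)
  finally show ?thesis .
qed

section \<open>Reduction of the random sequence to finitely many type sequences\<close>

theorem lemma2:
  fixes P :: "(real ^ 'n) measure" and L :: nat and p :: "nat \<Rightarrow> real"
    and \<beta> :: "nat \<Rightarrow> real ^ 'n" and T :: nat and q :: ereal
    and M :: "'a measure" and b :: "nat \<Rightarrow> 'a \<Rightarrow> real ^ 'n"
  assumes "admissible P L p \<beta>"
    and "T \<ge> 1"
    and "q \<le> 1"
    and "prob_space M"
    and "prob_space.indep_vars M (\<lambda>_. P) b {1..T}"
    and "\<And>t. t \<in> {1..T} \<Longrightarrow> distr M P (b t) = P"
  shows "prob_space.expectation M (\<lambda>\<omega>. OPT q T (\<lambda>t. b t \<omega>)) \<le> FLU q T L p \<beta>"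
proof -
  interpret prob_space M by fact
  have \<beta>: "0 \<le> \<beta> l $ i" and p: "0 < p l" and P\<beta>: "measure P {\<beta> l} = p l"
    if "l \<in> {1..L}" for l i
    using assms(1) that by (auto simp: admissible_def unit_cube_def)
  have inj: "inj_on \<beta> {1..L}" and sum_p: "(\<Sum>l\<in>{1..L}. p l) = 1"
    using assms(1) by (auto simp: admissible_def)
  have b[measurable]: "b t \<in> measurable M P" if "t \<in> {1..T}" for t
    using assms(5) that by (auto simp: indep_vars_def)
  define E where "E t l = {\<omega> \<in> space M. b t \<omega> = \<beta> l}" for t l
  have E_vimage: "E t l = b t -` {\<beta> l} \<inter> space M" for t l
    by (auto simp: E_def)
  \<comment> \<open>A set outside the sigma-algebra has \<open>measure\<close> 0 by default, so
    positive mass forces the singleton to be measurable.\<close>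
  have \<beta>_sets: "{\<beta> l} \<in> sets P" if "l \<in> {1..L}" for l
    using P\<beta>[OF that] p[OF that] measure_notin_sets[of "{\<beta> l}" P] by fastforce
  have E_sets: "E t l \<in> events" if "t \<in> {1..T}" "l \<in> {1..L}" for t l
    unfolding E_vimage using b \<beta>_sets that by (intro measurable_sets)
  have prob_E: "prob (E t l) = p l" if "t \<in> {1..T}" "l \<in> {1..L}" for t l
    unfolding E_vimage measure_distr[OF b[OF that(1)] \<beta>_sets[OF that(2)], symmetric]
      assms(6)[OF that(1)] by (rule P\<beta>[OF that(2)])
  have E_disjoint: "disjoint_family_on (E t) {1..L}" for t
    unfolding disjoint_family_on_def
  proof (intro ballI impI)
    fix l l' assume "l \<in> {1..L}" "l' \<in> {1..L}" "l \<noteq> l'"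
    then have "\<beta> l \<noteq> \<beta> l'" using inj_onD[OF inj] by blast
    then show "E t l \<inter> E t l' = {}" by (auto simp: E_def)
  qed
  \<comment> \<open>For each period the type events are disjoint and their probabilities add up to
    1; finitely many periods combine to one null set.\<close>
  have AE_E: "AE \<omega> in M. \<forall>t\<in>{1..T}. \<exists>l\<in>{1..L}. \<omega> \<in> E t l"
  proof (rule AE_finite_allI)
    fix t assume t: "t \<in> {1..T}"
    have "prob (\<Union>l\<in>{1..L}. E t l) = 1"
      using t E_sets E_disjoint prob_E sum_p by (subst finite_measure_finite_Union) auto
    then have "AE \<omega> in M. \<omega> \<in> (\<Union>l\<in>{1..L}. E t l)"
      by (rule AE_prob_1)
    then show "AE \<omega> in M. \<exists>l\<in>{1..L}. \<omega> \<in> E t l" by simp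
  qed simp

  \<comment> \<open>The event \<open>A k\<close> says that the type sequence \<open>k\<close> is
    realised. Extensionality makes \<open>K\<close> finite and makes distinct members differ at some
    period in the horizon, which gives disjointness of the events.\<close>
  define K where "K = PiE {1..T} (\<lambda>_. {1..L})"
  define A where "A k = (\<Inter>t\<in>{1..T}. E t (k t))" for k
  have K: "finite K" by (auto simp: K_def intro: finite_PiE)
  have K_range: "k t \<in> {1..L}" if "k \<in> K" "t \<in> {1..T}" for k t
    using that unfolding K_def by (rule PiE_mem)
  have A_sets: "A k \<in> events" if "k \<in> K" for k
    unfolding A_def using that assms(2) K_range by (intro sets.finite_INT E_sets) auto
  have A_disjoint: "disjoint_family_on A K"
    unfolding disjoint_family_on_def
  proof (intro ballI impI)
    fix k k' assume k: "k \<in> K" "k' \<in> K" "k \<noteq> k'"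
    then obtain t where "t \<in> {1..T}" "k t \<noteq> k' t"
      unfolding K_def by (meson PiE_ext)
    moreover from this have "E t (k t) \<inter> E t (k' t) = {}"
      using E_disjoint[of t] K_range[of k t] K_range[of k' t] k by (auto simp: disjoint_family_on_def)
    ultimately show "A k \<inter> A k' = {}" unfolding A_def by blast
  qed
  have AE_A: "AE \<omega> in M. \<exists>k\<in>K. \<omega> \<in> A k"
    using AE_E
  proof eventually_elim
    case (elim \<omega>)
    then obtain k where "\<forall>t\<in>{1..T}. k t \<in> {1..L} \<and> \<omega> \<in> E t (k t)" by metis
    \<comment> \<open>The chosen \<open>k\<close> is arbitrary outside the horizon; restricting it
      gives a member of \<open>K\<close>.\<close>
    then show ?case by (intro bexI[of _ "restrict k {1..T}"]) (auto simp: A_def K_def)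
  qed

  have marginal: "(\<Sum>k\<in>{k \<in> K. k t = l}. prob (A k)) = p l"
    if "t \<in> {1..T}" "l \<in> {1..L}" for t l
  proof -
    have "(\<Sum>k\<in>{k \<in> K. k t = l}. prob (A k)) = prob (\<Union>k\<in>{k \<in> K. k t = l}. A k)"
      using K A_sets A_disjoint
      by (intro finite_measure_finite_Union[symmetric]) (auto simp: disjoint_family_on_def)
    \<comment> \<open>The events \<open>A k\<close> with \<open>k t = l\<close> fill
      \<open>E t l\<close> up to a null set on which some period leaves the support, hence the
      almost-everywhere comparison.\<close>
    also have "\<dots> = prob (E t l)"
    proof (rule finite_measure_eq_AE)
      show "AE \<omega> in M. \<omega> \<in> (\<Union>k\<in>{k \<in> K. k t = l}. A k) \<longleftrightarrow> \<omega> \<in> E t l"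
        using AE_A
      proof eventually_elim
        case (elim \<omega>)
        then obtain k where k: "k \<in> K" "\<omega> \<in> A k" by blast
        then have "\<omega> \<in> E t (k t)" and "k t \<in> {1..L}"
          using that(1) K_range by (auto simp: A_def)
        then have "k t = l" if "\<omega> \<in> E t l"
          using disjoint_family_onD[OF E_disjoint[of t], of "k t" l] that \<open>l \<in> {1..L}\<close> by blast
        moreover have "A k' \<subseteq> E t (k' t)" for k'
          using that(1) by (auto simp: A_def)
        ultimately show ?case using k by blast
      qed
    qed (use K A_sets E_sets that in auto)
    finally show ?thesis using prob_E that by simp
  qed

  let ?O = "\<lambda>k. OPT q T (\<lambda>t. \<beta> (k t))"
  have O_nonneg: "0 \<le> ?O k" if "k \<in> K" for k
    using \<beta> K_range that by (intro OPT_nonneg assms(3)) blast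
  have "expectation (\<lambda>\<omega>. OPT q T (\<lambda>t. b t \<omega>)) \<le> expectation (\<lambda>\<omega>. \<Sum>k\<in>K. indicator (A k) \<omega> * ?O k)"
    \<comment> \<open>\<open>OPT\<close> is uncontrolled on the null set where \<open>b t\<close> leaves the support, so it may fail to be
      measurable; its integral is then 0, which a nonnegative integrable majorant also covers.\<close>
  proof (rule integral_mono_AE')
    show "integrable M (\<lambda>\<omega>. \<Sum>k\<in>K. indicator (A k) \<omega> * ?O k)"
      using A_sets by (intro Bochner_Integration.integrable_sum integrable_mult_left)
        (auto simp: less_top[symmetric])
    show "AE \<omega> in M. 0 \<le> (\<Sum>k\<in>K. indicator (A k) \<omega> * ?O k)"
      using O_nonneg by (auto intro!: sum_nonneg)
    show "AE \<omega> in M. OPT q T (\<lambda>t. b t \<omega>) \<le> (\<Sum>k\<in>K. indicator (A k) \<omega> * ?O k)"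
      using AE_A
    proof eventually_elim
      case (elim \<omega>)
      then obtain k where k: "k \<in> K" "\<omega> \<in> A k" by blast
      then have "OPT q T (\<lambda>t. b t \<omega>) = ?O k"
        by (intro OPT_cong) (auto simp: A_def E_def)
      also have "\<dots> = indicator (A k) \<omega> * ?O k" using k by simp
      also have "\<dots> \<le> (\<Sum>k\<in>K. indicator (A k) \<omega> * ?O k)"
        using K k O_nonneg by (intro member_le_sum) auto
      finally show ?case .
    qed
  qed
  also have "\<dots> = (\<Sum>k\<in>K. prob (A k) * ?O k)"
    using A_sets by (subst Bochner_Integration.integral_sum) (auto simp: less_top[symmetric])
  \<comment> \<open>The probabilities \<open>prob (A k)\<close> serve as the weights
    \<open>W\<close>.\<close>
  also have "\<dots> \<le> FLU q T L p \<beta>"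
    using assms(2,3) p \<beta> K marginal K_range by (intro sum_OPT_le_FLU) auto
  finally show ?thesis .
qed

end
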